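(* Let $\theta \in \mathcal{L}$. Then $\theta$ is satisfiable in a multi-agent epistemic model if and only if there exists a multi-agent epistemic Hintikka structure for $\theta$.
   Context: Fix a nonempty set $\mathbf{AP}$ of atomic propositions and a finite set $\Sigma$ of agents with at least two elements. The language $\mathcal{L}$ is given by $\varphi ::= p \mid \neg\varphi \mid \varphi_1 \wedge \varphi_2 \mid K_a\varphi \mid D\varphi \mid C\varphi$, with $p \in \mathbf{AP}$, $a \in \Sigma$. A multi-agent epistemic structure (MAES) is a tuple $(\Sigma, S, \{R_a\}_{a\in\Sigma}, R_D, R_C)$ with $S\neq\emptyset$, $R_a, R_D$ binary relations on $S$, and $R_C$ the transitive closure of $R_D \cup \bigcup_{a} R_a$. A multi-agent epistemic model (MAEM) is such a structure in which every $R_a$ and $R_D$ is an equivalence relation and $R_D = \bigcap_{a \in \Sigma} R_a$, together with a labeling $L : S \to \mathcal{P}(\mathbf{AP})$. Satisfaction is standard: $p$ holds at $s$ iff $p\in L(s)$, Booleans as usual, $\mathcal{M},s\models K_a\varphi$ iff $\varphi$ holds at all $t$ with $(s,t)\in R_a$, and similarly $D$ with $R_D$ and $C$ with $R_C$. $\theta$ is satisfiable in a MAEM if $\mathcal{M},s\models\theta$ for some MAEM $\mathcal{M}$ and state $s$. A set $\Delta \subseteq \mathcal{L}$ is fully expanded if: $\neg\neg\varphi\in\Delta$ implies $\varphi\in\Delta$; $\varphi\wedge\psi\in\Delta$ implies $\varphi,\psi\in\Delta$; $\neg(\varphi\wedge\psi)\in\Delta$ implies $\neg\varphi\in\Delta$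 or $\neg\psi\in\Delta$; $K_a\varphi\in\Delta$ implies $D\varphi\in\Delta$; $D\varphi\in\Delta$ implies $\varphi\in\Delta$; $C\varphi\in\Delta$ implies $K_a(\varphi\wedge C\varphi)\in\Delta$ for every $a\in\Sigma$; $\neg C\varphi\in\Delta$ implies $\neg K_a(\varphi\wedge C\varphi)\in\Delta$ for some $a\in\Sigma$; and if $\varphi\in\Delta$ and $\psi$ is a subformula of $\varphi$ of the form $K_a\chi$ or $D\chi$, then $\psi\in\Delta$ or $\neg\psi\in\Delta$. A multi-agent epistemic Hintikka structure (MAEHS) is a tuple $(\Sigma, S, \{R_a\}, R_D, R_C, H)$ where $(\Sigma,S,\{R_a\},R_D,R_C)$ is a MAES and $H$ assigns to each $s\in S$ a set $H(s)\subseteq\mathcal{L}$ such that: (H1) if $\neg\varphi\in H(s)$ then $\varphi\notin H(s)$; (H2) each $H(s)$ is fully expanded; (H3) if $K_a\varphi\in H(s)$ and $(s,t)\in R_a$ then $\varphi\in H(t)$; (H4) if $\neg K_a\varphi\in H(s)$ then there is $t$ with $(s,t)\in R_a$ and $\neg\varphi\in H(t)$; (H5) if $(s,t)\in R_a$ then $K_a\varphi\in H(s)$ iff $K_a\varphi\in H(t)$; (H6) if $D\varphi\in H(s)$ and $(s,t)\in R_D$ then $\varphi\in H(t)$; (H7) if $\neg D\varphi\in H(s)$ then there is $t$ with $(s,t)\in R_D$ and $\neg\varphi\in H(t)$; (H8) if $(s,t)\in R_D$ then $D\varphi\in H(s)$ iff $D\varphi\in H(t)$, and $K_a\varphi\in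 H(s)$ iff $K_a\varphi\in H(t)$ for every $a\in\Sigma$; (H9) if $\neg C\varphi\in H(s)$ then there is $t$ with $(s,t)\in R_C$ and $\neg\varphi\in H(t)$. It is a MAEHS for $\theta$ if $\theta\in H(s)$ for some $s\in S$. *)

theory Defs
  imports Main "HOL-Library.Cardinality"
begin

text \<open>
  The type parameter 'p is the (automatically nonempty) set of atomic propositions and 'a the set
  of agents; finiteness of 'a and the existence of at least two agents are assumed where needed.
\<close>

datatype ('p, 'a) fm =
    Atom 'p
  | Neg "('p, 'a) fm"
  | Conj "('p, 'a) fm" "('p, 'a) fm"
  | K 'a "('p, 'a) fm"
  | D "('p, 'a) fm"
  | C "('p, 'a) fm"

primrec subformulas :: "('p, 'a) fm \<Rightarrow> ('p, 'a) fm set" where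
  "subformulas (Atom p) = {Atom p}"
| "subformulas (Neg \<phi>) = insert (Neg \<phi>) (subformulas \<phi>)"
| "subformulas (Conj \<phi> \<psi>) = insert (Conj \<phi> \<psi>) (subformulas \<phi> \<union> subformulas \<psi>)"
| "subformulas (K a \<phi>) = insert (K a \<phi>) (subformulas \<phi>)"
| "subformulas (D \<phi>) = insert (D \<phi>) (subformulas \<phi>)"
| "subformulas (C \<phi>) = insert (C \<phi>) (subformulas \<phi>)"

record ('a, 's) epistemic_structure =
  states :: "'s set"
  rel :: "'a \<Rightarrow> ('s \<times> 's) set"
  relD :: "('s \<times> 's) set"
  relC :: "('s \<times> 's) set"

record ('p, 'a, 's) labelled_structure = "('a, 's) epistemic_structure" +
  label :: "'s \<Rightarrow> 'p set"

record ('p, 'a, 's) hintikka_structure = "('a, 's) epistemic_structure" +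
  hint :: "'s \<Rightarrow> ('p, 'a) fm set"

definition MAES :: "('a, 's, 'z) epistemic_structure_scheme \<Rightarrow> bool" where
  "MAES M \<longleftrightarrow>
     states M \<noteq> {} \<and>
     (\<forall>a. rel M a \<subseteq> states M \<times> states M) \<and>
     relD M \<subseteq> states M \<times> states M \<and>
     relC M = (relD M \<union> (\<Union>a. rel M a))\<^sup>+"

definition MAEM :: "('p, 'a, 's) labelled_structure \<Rightarrow> bool" where
  "MAEM M \<longleftrightarrow>
     MAES M \<and>
     (\<forall>a. equiv (states M) (rel M a)) \<and>
     equiv (states M) (relD M) \<and>
     relD M = (\<Inter>a. rel M a)"

primrec sat :: "('p, 'a, 's) labelled_structure \<Rightarrow> 's \<Rightarrow> ('p, 'a) fm \<Rightarrow> bool" where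
  "sat M s (Atom p) \<longleftrightarrow> p \<in> label M s"
| "sat M s (Neg \<phi>) \<longleftrightarrow> \<not> sat M s \<phi>"
| "sat M s (Conj \<phi> \<psi>) \<longleftrightarrow> sat M s \<phi> \<and> sat M s \<psi>"
| "sat M s (K a \<phi>) \<longleftrightarrow> (\<forall>t. (s, t) \<in> rel M a \<longrightarrow> sat M t \<phi>)"
| "sat M s (D \<phi>) \<longleftrightarrow> (\<forall>t. (s, t) \<in> relD M \<longrightarrow> sat M t \<phi>)"
| "sat M s (C \<phi>) \<longleftrightarrow> (\<forall>t. (s, t) \<in> relC M \<longrightarrow> sat M t \<phi>)"

definition fully_expanded :: "('p, 'a) fm set \<Rightarrow> bool" where
  "fully_expanded \<Delta> \<longleftrightarrow>
     (\<forall>\<phi>. Neg (Neg \<phi>) \<in> \<Delta> \<longrightarrow> \<phi> \<in> \<Delta>) \<and>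
     (\<forall>\<phi> \<psi>. Conj \<phi> \<psi> \<in> \<Delta> \<longrightarrow> \<phi> \<in> \<Delta> \<and> \<psi> \<in> \<Delta>) \<and>
     (\<forall>\<phi> \<psi>. Neg (Conj \<phi> \<psi>) \<in> \<Delta> \<longrightarrow> Neg \<phi> \<in> \<Delta> \<or> Neg \<psi> \<in> \<Delta>) \<and>
     (\<forall>a \<phi>. K a \<phi> \<in> \<Delta> \<longrightarrow> D \<phi> \<in> \<Delta>) \<and>
     (\<forall>\<phi>. D \<phi> \<in> \<Delta> \<longrightarrow> \<phi> \<in> \<Delta>) \<and>
     (\<forall>\<phi>. C \<phi> \<in> \<Delta> \<longrightarrow> (\<forall>a. K a (Conj \<phi> (C \<phi>)) \<in> \<Delta>)) \<and>
     (\<forall>\<phi>. Neg (C \<phi>) \<in> \<Delta> \<longrightarrow> (\<exists>a. Neg (K a (Conj \<phi> (C \<phi>))) \<in> \<Delta>)) \<and>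
     (\<forall>\<phi> \<psi>. \<phi> \<in> \<Delta> \<and> \<psi> \<in> subformulas \<phi> \<and> ((\<exists>a \<chi>. \<psi> = K a \<chi>) \<or> (\<exists>\<chi>. \<psi> = D \<chi>)) \<longrightarrow>
        \<psi> \<in> \<Delta> \<or> Neg \<psi> \<in> \<Delta>)"

definition MAEHS :: "('p, 'a, 's) hintikka_structure \<Rightarrow> bool" where
  "MAEHS N \<longleftrightarrow>
     MAES N \<and>
     (\<forall>s\<in>states N. \<forall>\<phi>. Neg \<phi> \<in> hint N s \<longrightarrow> \<phi> \<notin> hint N s) \<and>
     (\<forall>s\<in>states N. fully_expanded (hint N s)) \<and>
     (\<forall>s\<in>states N. \<forall>t a \<phi>. K a \<phi> \<in> hint N s \<and> (s, t) \<in> rel N a \<longrightarrow> \<phi> \<in> hint N t) \<and>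
     (\<forall>s\<in>states N. \<forall>a \<phi>. Neg (K a \<phi>) \<in> hint N s \<longrightarrow>
        (\<exists>t. (s, t) \<in> rel N a \<and> Neg \<phi> \<in> hint N t)) \<and>
     (\<forall>s t a. (s, t) \<in> rel N a \<longrightarrow> (\<forall>\<phi>. K a \<phi> \<in> hint N s \<longleftrightarrow> K a \<phi> \<in> hint N t)) \<and>
     (\<forall>s\<in>states N. \<forall>t \<phi>. D \<phi> \<in> hint N s \<and> (s, t) \<in> relD N \<longrightarrow> \<phi> \<in> hint N t) \<and>
     (\<forall>s\<in>states N. \<forall>\<phi>. Neg (D \<phi>) \<in> hint N s \<longrightarrow>
        (\<exists>t. (s, t) \<in> relD N \<and> Neg \<phi> \<in> hint N t)) \<and>
     (\<forall>s t. (s, t) \<in> relD N \<longrightarrow>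
        (\<forall>\<phi>. D \<phi> \<in> hint N s \<longleftrightarrow> D \<phi> \<in> hint N t) \<and>
        (\<forall>a \<phi>. K a \<phi> \<in> hint N s \<longleftrightarrow> K a \<phi> \<in> hint N t)) \<and>
     (\<forall>s\<in>states N. \<forall>\<phi>. Neg (C \<phi>) \<in> hint N s \<longrightarrow>
        (\<exists>t. (s, t) \<in> relC N \<and> Neg \<phi> \<in> hint N t))"

definition MAEHS_for :: "('p, 'a) fm \<Rightarrow> ('p, 'a, 's) hintikka_structure \<Rightarrow> bool" where
  "MAEHS_for \<theta> N \<longleftrightarrow> MAEHS N \<and> (\<exists>s\<in>states N. \<theta> \<in> hint N s)"

text \<open>
  HOL cannot quantify over types inside a formula, so existence of a structure is relative to a
  type from which the states are drawn. The state set itself is an arbitrary nonempty subset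
  of that type. The notions are only meant for infinite types: a finite type bounds the number of
  states, which the informal notions do not.
\<close>

definition satisfiable :: "'s itself \<Rightarrow> ('p, 'a) fm \<Rightarrow> bool" where
  "satisfiable (_ :: 's itself) \<theta> \<longleftrightarrow>
     (\<exists>M :: ('p, 'a, 's) labelled_structure. MAEM M \<and> (\<exists>s\<in>states M. sat M s \<theta>))"

definition has_MAEHS :: "'s itself \<Rightarrow> ('p, 'a) fm \<Rightarrow> bool" where
  "has_MAEHS (_ :: 's itself) \<theta> \<longleftrightarrow>
     (\<exists>N :: ('p, 'a, 's) hintikka_structure. MAEHS_for \<theta> N)"

end

theory Submission
  imports Defs "HOL-Library.Countable_Set"
begin

text \<open>
  The truth sets of a model form a Hintikka structure. Conversely, a Hintikka structure is
  unravelled from a state containing \<open>\<theta>\<close> into the tree of finite paths along its \<open>K\<close>- and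
  \<open>D\<close>-edges; two paths are indistinguishable for agent \<open>a\<close> when they agree after removal of their
  longest final segments made of \<open>a\<close>- and \<open>D\<close>-edges. With at least two agents, the intersection of
  these equivalences is the one obtained by removing \<open>D\<close>-edges only. The size of the state type
  plays no role because a Hintikka structure for \<open>\<theta>\<close> can first be collapsed to a finite one:
  restrict the Hintikka sets to a finite closure of \<open>\<theta>\<close> and identify states with equal sets.
\<close>

section \<open>From models to Hintikka structures\<close>

text \<open>As an intersection over a nonempty type of agents, \<open>relD M\<close> adds no pair to
  the union of the \<open>rel M a\<close>. So every step of an \<open>relC\<close>-chain can be read
  as a step of some agent, which is what the expansion rules for \<open>C\<close>, stated with
  \<open>K\<close> alone, call for.\<close>

lemma MAEM_relC_Un_rel:
  fixes M :: "('p, 'a, 's) labelled_structure"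
  assumes "MAEM M"
  shows "relC M = (\<Union>a. rel M a)\<^sup>+"
proof -
  have "relD M \<union> (\<Union>a. rel M a) = (\<Union>a. rel M a)"
    using assms unfolding MAEM_def by blast
  then show ?thesis
    using assms unfolding MAEM_def MAES_def by simp
qed

text \<open>Most clauses are the semantics of the connectives together with reflexivity, symmetry
  and transitivity. The work is in the rules for \<open>C\<close>: they say that common knowledge is
  a fixed point, and \<open>C_step\<close> and \<open>C_intro\<close> are its two
  directions.\<close>

lemma MAEHS_truth_sets:
  fixes M :: "('p, 'a, 's) labelled_structure"
  assumes "MAEM M"
  shows "MAEHS \<lparr>states = states M, rel = rel M, relD = relD M, relC = relC M,
                  hint = (\<lambda>s. {\<phi>. sat M s \<phi>})\<rparr>"
proof -
  have refl: "(s, s) \<in> rel M a" "(s, s) \<in> relD M" if "s \<in> states M" for s a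
    using assms that unfolding MAEM_def equiv_def refl_on_def by blast+
  have relD: "relD M = (\<Inter>a. rel M a)"
    using assms unfolding MAEM_def by blast
  have sym: "(t, s) \<in> rel M a" if "(s, t) \<in> rel M a" for s t a
    using assms that unfolding MAEM_def equiv_def sym_def by blast
  have trans: "(s, u) \<in> rel M a" if "(s, t) \<in> rel M a" "(t, u) \<in> rel M a" for s t u a
    using assms that unfolding MAEM_def equiv_def trans_def by blast
  have relC: "relC M = (\<Union>a. rel M a)\<^sup>+"
    by (rule MAEM_relC_Un_rel[OF assms])
  have C_step: "sat M t \<phi> \<and> sat M t (C \<phi>)" if "sat M s (C \<phi>)" "(s, t) \<in> rel M a" for s t a \<phi>
  proof -
    have st: "(s, t) \<in> (\<Union>a. rel M a)"
      using that by blast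
    then have "(s, t) \<in> relC M"
      by (auto simp: relC)
    moreover have "(s, u) \<in> relC M" if "(t, u) \<in> relC M" for u
      using that st unfolding relC by (rule trancl_into_trancl2[rotated])
    ultimately show ?thesis
      using that by auto
  qed
  \<comment> \<open>Split an \<open>relC\<close>-chain after its first edge. The contrapositive
    supplies the agent in the rule for \<open>Neg (C \<phi>)\<close>: if \<open>C \<phi>\<close>
    fails at \<open>s\<close>, then some agent has a successor of \<open>s\<close> where
    \<open>\<phi>\<close> or \<open>C \<phi>\<close> fails.\<close>
  have C_intro: "sat M s (C \<phi>)" if step: "\<And>t a. (s, t) \<in> rel M a \<Longrightarrow> sat M t \<phi> \<and> sat M t (C \<phi>)" for s \<phi>
  proof -
    have "sat M t \<phi>" if "(s, t) \<in> relC M" for t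
    proof -
      from that obtain u a where "(s, u) \<in> rel M a" "u = t \<or> (u, t) \<in> relC M"
        unfolding relC by (cases rule: converse_tranclE) blast+
      then show ?thesis
        using step[of u a] by auto
    qed
    then show ?thesis by simp
  qed
  have "fully_expanded {\<phi>. sat M s \<phi>}" if "s \<in> states M" for s
    unfolding fully_expanded_def
  proof (intro conjI)
    show "\<forall>\<phi>. C \<phi> \<in> {\<phi>. sat M s \<phi>} \<longrightarrow> (\<forall>a. K a (Conj \<phi> (C \<phi>)) \<in> {\<phi>. sat M s \<phi>})"
      using C_step unfolding mem_Collect_eq sat.simps(3,4) by blast
    show "\<forall>\<phi>. Neg (C \<phi>) \<in> {\<phi>. sat M s \<phi>} \<longrightarrow>
      (\<exists>a. Neg (K a (Conj \<phi> (C \<phi>))) \<in> {\<phi>. sat M s \<phi>})"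
      using C_intro unfolding mem_Collect_eq sat.simps(2,3,4) by metis
  qed (use refl[OF that] relD in \<open>auto\<close>)
  moreover have "MAES \<lparr>states = states M, rel = rel M, relD = relD M, relC = relC M,
                  hint = (\<lambda>s. {\<phi>. sat M s \<phi>})\<rparr>"
    using conjunct1[OF assms[unfolded MAEM_def]] unfolding MAES_def by simp
  moreover have "sat M s (K a \<phi>) \<longleftrightarrow> sat M t (K a \<phi>)" if "(s, t) \<in> rel M a" for s t a \<phi>
    using that by (auto intro: sym trans)
  moreover have "sat M s (D \<phi>) \<longleftrightarrow> sat M t (D \<phi>)" if "(s, t) \<in> relD M" for s t \<phi>
  proof -
    have "equiv (states M) (relD M)"
      using assms unfolding MAEM_def by blast
    then have "(s, u) \<in> relD M \<longleftrightarrow> (t, u) \<in> relD M" for u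
      using that by (meson equivE symD transD)
    then show ?thesis by simp
  qed
  ultimately show ?thesis
    unfolding MAEHS_def using relD by simp
qed

section \<open>Collapsing a Hintikka structure to a finite one\<close>

lemma MAEHS_D:
  assumes "MAEHS N"
  shows "MAES N"
    and "s \<in> states N \<Longrightarrow> Neg \<phi> \<in> hint N s \<Longrightarrow> \<phi> \<notin> hint N s"
    and "s \<in> states N \<Longrightarrow> fully_expanded (hint N s)"
    and "s \<in> states N \<Longrightarrow> K a \<phi> \<in> hint N s \<Longrightarrow> (s, t) \<in> rel N a \<Longrightarrow> \<phi> \<in> hint N t"
    and "s \<in> states N \<Longrightarrow> Neg (K a \<phi>) \<in> hint N s \<Longrightarrow> \<exists>t. (s, t) \<in> rel N a \<and> Neg \<phi> \<in> hint N t"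
    and "(s, t) \<in> rel N a \<Longrightarrow> K a \<phi> \<in> hint N s \<longleftrightarrow> K a \<phi> \<in> hint N t"
    and "s \<in> states N \<Longrightarrow> D \<phi> \<in> hint N s \<Longrightarrow> (s, t) \<in> relD N \<Longrightarrow> \<phi> \<in> hint N t"
    and "s \<in> states N \<Longrightarrow> Neg (D \<phi>) \<in> hint N s \<Longrightarrow> \<exists>t. (s, t) \<in> relD N \<and> Neg \<phi> \<in> hint N t"
    and "(s, t) \<in> relD N \<Longrightarrow> D \<phi> \<in> hint N s \<longleftrightarrow> D \<phi> \<in> hint N t"
    and "(s, t) \<in> relD N \<Longrightarrow> K a \<phi> \<in> hint N s \<longleftrightarrow> K a \<phi> \<in> hint N t"
    and "s \<in> states N \<Longrightarrow> Neg (C \<phi>) \<in> hint N s \<Longrightarrow> \<exists>t. (s, t) \<in> relC N \<and> Neg \<phi> \<in> hint N t"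
proof -
  note c1 = assms[unfolded MAEHS_def]
  note c2 = conjunct2[OF c1]
  note c3 = conjunct2[OF c2]
  note c4 = conjunct2[OF c3]
  note c5 = conjunct2[OF c4]
  note c6 = conjunct2[OF c5]
  note c7 = conjunct2[OF c6]
  note c8 = conjunct2[OF c7]
  note c9 = conjunct2[OF c8]
  note c10 = conjunct2[OF c9]
  show "MAES N"
    using conjunct1[OF c1] by blast
  show "\<phi> \<notin> hint N s" if "s \<in> states N" "Neg \<phi> \<in> hint N s"
    using that conjunct1[OF c2] by blast
  show "fully_expanded (hint N s)" if "s \<in> states N"
    using that conjunct1[OF c3] by blast
  show "\<phi> \<in> hint N t" if "s \<in> states N" "K a \<phi> \<in> hint N s" "(s, t) \<in> rel N a"
    using that conjunct1[OF c4] by blast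
  show "\<exists>t. (s, t) \<in> rel N a \<and> Neg \<phi> \<in> hint N t" if "s \<in> states N" "Neg (K a \<phi>) \<in> hint N s"
    using that conjunct1[OF c5] by blast
  show "K a \<phi> \<in> hint N s \<longleftrightarrow> K a \<phi> \<in> hint N t" if "(s, t) \<in> rel N a"
    using that conjunct1[OF c6] by blast
  show "\<phi> \<in> hint N t" if "s \<in> states N" "D \<phi> \<in> hint N s" "(s, t) \<in> relD N"
    using that conjunct1[OF c7] by blast
  show "\<exists>t. (s, t) \<in> relD N \<and> Neg \<phi> \<in> hint N t" if "s \<in> states N" "Neg (D \<phi>) \<in> hint N s"
    using that conjunct1[OF c8] by blast
  show "D \<phi> \<in> hint N s \<longleftrightarrow> D \<phi> \<in> hint N t" if "(s, t) \<in> relD N"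
    using that conjunct1[OF c9] by blast
  show "K a \<phi> \<in> hint N s \<longleftrightarrow> K a \<phi> \<in> hint N t" if "(s, t) \<in> relD N"
    using that conjunct1[OF c9] by blast
  show "\<exists>t. (s, t) \<in> relC N \<and> Neg \<phi> \<in> hint N t" if "s \<in> states N" "Neg (C \<phi>) \<in> hint N s"
    using that c10 by blast
qed

lemma fully_expanded_D:
  assumes "fully_expanded \<Delta>"
  shows "Neg (Neg \<phi>) \<in> \<Delta> \<Longrightarrow> \<phi> \<in> \<Delta>"
    and "Conj \<phi> \<psi> \<in> \<Delta> \<Longrightarrow> \<phi> \<in> \<Delta> \<and> \<psi> \<in> \<Delta>"
    and "Neg (Conj \<phi> \<psi>) \<in> \<Delta> \<Longrightarrow> Neg \<phi> \<in> \<Delta> \<or> Neg \<psi> \<in> \<Delta>"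
    and "K a \<phi> \<in> \<Delta> \<Longrightarrow> D \<phi> \<in> \<Delta>"
    and "D \<phi> \<in> \<Delta> \<Longrightarrow> \<phi> \<in> \<Delta>"
    and "C \<phi> \<in> \<Delta> \<Longrightarrow> K a (Conj \<phi> (C \<phi>)) \<in> \<Delta>"
    and "Neg (C \<phi>) \<in> \<Delta> \<Longrightarrow> \<exists>a. Neg (K a (Conj \<phi> (C \<phi>))) \<in> \<Delta>"
    and "\<phi> \<in> \<Delta> \<Longrightarrow> \<psi> \<in> subformulas \<phi> \<Longrightarrow> (\<exists>a \<chi>. \<psi> = K a \<chi>) \<or> (\<exists>\<chi>. \<psi> = D \<chi>) \<Longrightarrow>
      \<psi> \<in> \<Delta> \<or> Neg \<psi> \<in> \<Delta>"
proof -
  note c1 = assms[unfolded fully_expanded_def]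
  note c2 = conjunct2[OF c1]
  note c3 = conjunct2[OF c2]
  note c4 = conjunct2[OF c3]
  note c5 = conjunct2[OF c4]
  note c6 = conjunct2[OF c5]
  note c7 = conjunct2[OF c6]
  note c8 = conjunct2[OF c7]
  show "\<phi> \<in> \<Delta>" if "Neg (Neg \<phi>) \<in> \<Delta>"
    using that conjunct1[OF c1] by blast
  show "\<phi> \<in> \<Delta> \<and> \<psi> \<in> \<Delta>" if "Conj \<phi> \<psi> \<in> \<Delta>"
    using that conjunct1[OF c2] by blast
  show "Neg \<phi> \<in> \<Delta> \<or> Neg \<psi> \<in> \<Delta>" if "Neg (Conj \<phi> \<psi>) \<in> \<Delta>"
    using that conjunct1[OF c3] by blast
  show "D \<phi> \<in> \<Delta>" if "K a \<phi> \<in> \<Delta>"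
    using that conjunct1[OF c4] by blast
  show "\<phi> \<in> \<Delta>" if "D \<phi> \<in> \<Delta>"
    using that conjunct1[OF c5] by blast
  show "K a (Conj \<phi> (C \<phi>)) \<in> \<Delta>" if "C \<phi> \<in> \<Delta>"
    using that conjunct1[OF c6] by blast
  show "\<exists>a. Neg (K a (Conj \<phi> (C \<phi>))) \<in> \<Delta>" if "Neg (C \<phi>) \<in> \<Delta>"
    using that conjunct1[OF c7] by blast
  show "\<psi> \<in> \<Delta> \<or> Neg \<psi> \<in> \<Delta>"
    if "\<phi> \<in> \<Delta>" "\<psi> \<in> subformulas \<phi>" "(\<exists>a \<chi>. \<psi> = K a \<chi>) \<or> (\<exists>\<chi>. \<psi> = D \<chi>)"
    using that c8 by blast
qed

text \<open>The formulas that the expansion rules produce from a given one, up to one negation.\<close>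

primrec expansion :: "('p, 'a) fm \<Rightarrow> ('p, 'a) fm set" where
  "expansion (Atom p) = {Atom p}"
| "expansion (Neg \<phi>) = insert (Neg \<phi>) (expansion \<phi>)"
| "expansion (Conj \<phi> \<psi>) = insert (Conj \<phi> \<psi>) (expansion \<phi> \<union> expansion \<psi>)"
| "expansion (K a \<phi>) = {K a \<phi>, D \<phi>} \<union> expansion \<phi>"
| "expansion (D \<phi>) = insert (D \<phi>) (expansion \<phi>)"
| "expansion (C \<phi>) = {C \<phi>, Conj \<phi> (C \<phi>), D (Conj \<phi> (C \<phi>))}
     \<union> range (\<lambda>a. K a (Conj \<phi> (C \<phi>))) \<union> expansion \<phi>"

lemma finite_expansion: "finite (expansion (\<theta> :: ('p, 'a::finite) fm))"
  by (induction \<theta>) auto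

lemma self_in_expansion: "\<theta> \<in> expansion \<theta>"
  by (cases \<theta>) auto

lemma subformulas_subset_expansion_self: "subformulas \<theta> \<subseteq> expansion \<theta>"
  by (induction \<theta>) auto

text \<open>Besides subformulas, \<open>expansion\<close> only adds \<open>D \<phi>\<close> for
  \<open>K a \<phi>\<close> and the unfoldings of \<open>C \<phi>\<close>, and the proper
  subformulas of these are already present.\<close>

lemma subformulas_subset_expansion: "\<chi> \<in> expansion \<theta> \<Longrightarrow> subformulas \<chi> \<subseteq> expansion \<theta>"
  by (induction \<theta>) (use subformulas_subset_expansion_self in \<open>fastforce+\<close>)

lemma self_in_subformulas: "\<phi> \<in> subformulas \<phi>"
  by (cases \<phi>) auto

lemma expansion_components:
  "Neg \<phi> \<in> expansion \<theta> \<Longrightarrow> \<phi> \<in> expansion \<theta>"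
  "Conj \<phi> \<psi> \<in> expansion \<theta> \<Longrightarrow> \<phi> \<in> expansion \<theta>"
  "Conj \<phi> \<psi> \<in> expansion \<theta> \<Longrightarrow> \<psi> \<in> expansion \<theta>"
  "K a \<phi> \<in> expansion \<theta> \<Longrightarrow> \<phi> \<in> expansion \<theta>"
  "D \<phi> \<in> expansion \<theta> \<Longrightarrow> \<phi> \<in> expansion \<theta>"
  "C \<phi> \<in> expansion \<theta> \<Longrightarrow> \<phi> \<in> expansion \<theta>"
  by (drule subformulas_subset_expansion, simp, use self_in_subformulas in blast)+

text \<open>The unfolding of \<open>C \<phi>\<close> introduces new \<open>K\<close>-formulas;
  \<open>D (Conj \<phi> (C \<phi>))\<close> is in \<open>expansion\<close> for their sake.\<close>

lemma K_expansion_D: "K a \<phi> \<in> expansion \<theta> \<Longrightarrow> D \<phi> \<in> expansion \<theta>"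
  by (induction \<theta>) auto

lemma C_expansion_K: "C \<phi> \<in> expansion \<theta> \<Longrightarrow> K a (Conj \<phi> (C \<phi>)) \<in> expansion \<theta>"
  by (induction \<theta>) auto

text \<open>A single extra negation suffices: whenever an expansion rule or a witness clause of
  \<open>MAEHS\<close> introduces a negation, it negates a member of
  \<open>expansion \<theta>\<close>.\<close>

definition closure :: "('p, 'a) fm \<Rightarrow> ('p, 'a) fm set" where
  "closure \<theta> = expansion \<theta> \<union> Neg ` expansion \<theta>"

lemma closure_iff:
  "Neg \<phi> \<in> closure \<theta> \<longleftrightarrow> \<phi> \<in> expansion \<theta>"
  "Conj \<phi> \<psi> \<in> closure \<theta> \<longleftrightarrow> Conj \<phi> \<psi> \<in> expansion \<theta>"
  "K a \<phi> \<in> closure \<theta> \<longleftrightarrow> K a \<phi> \<in> expansion \<theta>"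
  "D \<phi> \<in> closure \<theta> \<longleftrightarrow> D \<phi> \<in> expansion \<theta>"
  "C \<phi> \<in> closure \<theta> \<longleftrightarrow> C \<phi> \<in> expansion \<theta>"
  by (auto simp: closure_def dest: expansion_components(1))

lemma expansion_subset_closure: "\<phi> \<in> expansion \<theta> \<Longrightarrow> \<phi> \<in> closure \<theta>"
  by (simp add: closure_def)

text \<open>A modal formula is not itself a negation, so if it is a subformula of
  \<open>Neg \<chi>\<close>, it is one of \<open>\<chi>\<close>.\<close>

lemma modal_subformula_closure:
  assumes "\<phi> \<in> closure \<theta>" "\<psi> \<in> subformulas \<phi>" "(\<exists>a \<chi>. \<psi> = K a \<chi>) \<or> (\<exists>\<chi>. \<psi> = D \<chi>)"
  shows "\<psi> \<in> expansion \<theta>"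
  using assms subformulas_subset_expansion unfolding closure_def by fastforce

text \<open>Applied to a member of \<open>closure \<theta>\<close>, each rule has all its possible
  conclusions in \<open>closure \<theta>\<close>, so whatever \<Delta> contains by that rule
  survives the intersection.\<close>

lemma fully_expanded_Int_closure:
  assumes "fully_expanded \<Delta>"
  shows "fully_expanded (\<Delta> \<inter> closure \<theta>)"
  unfolding fully_expanded_def
proof (intro conjI)
  show "\<forall>\<phi> \<psi>. \<phi> \<in> \<Delta> \<inter> closure \<theta> \<and> \<psi> \<in> subformulas \<phi> \<and> ((\<exists>a \<chi>. \<psi> = K a \<chi>) \<or> (\<exists>\<chi>. \<psi> = D \<chi>))
    \<longrightarrow> \<psi> \<in> \<Delta> \<inter> closure \<theta> \<or> Neg \<psi> \<in> \<Delta> \<inter> closure \<theta>"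
  proof (intro allI impI)
    fix \<phi> \<psi> :: "('a, 'b) fm"
    assume *: "\<phi> \<in> \<Delta> \<inter> closure \<theta> \<and> \<psi> \<in> subformulas \<phi> \<and> ((\<exists>a \<chi>. \<psi> = K a \<chi>) \<or> (\<exists>\<chi>. \<psi> = D \<chi>))"
    then have "\<psi> \<in> \<Delta> \<or> Neg \<psi> \<in> \<Delta>"
      using fully_expanded_D(8)[OF assms, of \<phi> \<psi>] by blast
    moreover have "\<psi> \<in> closure \<theta>" "Neg \<psi> \<in> closure \<theta>"
      using modal_subformula_closure[of \<phi> \<theta> \<psi>] * by (auto simp: closure_def)
    ultimately show "\<psi> \<in> \<Delta> \<inter> closure \<theta> \<or> Neg \<psi> \<in> \<Delta> \<inter> closure \<theta>"
      by blast
  qed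
next
  show "\<forall>\<phi>. Neg (Neg \<phi>) \<in> \<Delta> \<inter> closure \<theta> \<longrightarrow> \<phi> \<in> \<Delta> \<inter> closure \<theta>"
    by (auto simp: closure_iff dest: fully_expanded_D(1)[OF assms] expansion_components(1)
      intro: expansion_subset_closure)
  show "\<forall>\<phi> \<psi>. Conj \<phi> \<psi> \<in> \<Delta> \<inter> closure \<theta> \<longrightarrow>
      \<phi> \<in> \<Delta> \<inter> closure \<theta> \<and> \<psi> \<in> \<Delta> \<inter> closure \<theta>"
    by (auto simp: closure_iff dest: fully_expanded_D(2)[OF assms] expansion_components(2,3)
      intro: expansion_subset_closure)
  show "\<forall>\<phi> \<psi>. Neg (Conj \<phi> \<psi>) \<in> \<Delta> \<inter> closure \<theta> \<longrightarrow>
      Neg \<phi> \<in> \<Delta> \<inter> closure \<theta> \<or> Neg \<psi> \<in> \<Delta> \<inter> closure \<theta>"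
    by (auto simp: closure_iff dest: fully_expanded_D(3)[OF assms] expansion_components(2,3))
  show "\<forall>a \<phi>. K a \<phi> \<in> \<Delta> \<inter> closure \<theta> \<longrightarrow> D \<phi> \<in> \<Delta> \<inter> closure \<theta>"
    by (auto simp: closure_iff dest: fully_expanded_D(4)[OF assms] K_expansion_D)
  show "\<forall>\<phi>. D \<phi> \<in> \<Delta> \<inter> closure \<theta> \<longrightarrow> \<phi> \<in> \<Delta> \<inter> closure \<theta>"
    by (auto simp: closure_iff dest: fully_expanded_D(5)[OF assms] expansion_components(5)
      intro: expansion_subset_closure)
  show "\<forall>\<phi>. C \<phi> \<in> \<Delta> \<inter> closure \<theta> \<longrightarrow> (\<forall>a. K a (Conj \<phi> (C \<phi>)) \<in> \<Delta> \<inter> closure \<theta>)"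
    by (auto simp: closure_iff dest: fully_expanded_D(6)[OF assms] intro: C_expansion_K)
  show "\<forall>\<phi>. Neg (C \<phi>) \<in> \<Delta> \<inter> closure \<theta> \<longrightarrow>
      (\<exists>a. Neg (K a (Conj \<phi> (C \<phi>))) \<in> \<Delta> \<inter> closure \<theta>)"
    by (auto simp: closure_iff dest: fully_expanded_D(7)[OF assms] intro: C_expansion_K)
qed

section \<open>The quotient by restricted Hintikka sets\<close>

lemma map_prod_subset: "r \<subseteq> A \<times> B \<Longrightarrow> map_prod f g ` r \<subseteq> f ` A \<times> g ` B"
  by auto

lemma trancl_map_prod: "(s, t) \<in> r\<^sup>+ \<Longrightarrow> (f s, f t) \<in> (map_prod f f ` r)\<^sup>+"
proof (induction rule: trancl_induct)
  case (step t u)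
  then have "(f t, f u) \<in> map_prod f f ` r"
    by force
  with step.IH show ?case
    by (rule trancl_into_trancl)
qed force

text \<open>A \<open>MAES\<close> need not have equivalences as relations, so direct images of the
  edges can be taken. The clauses on hints refer to a state only through its set and its edges;
  hence any preimage of a collapsed state, having the same restricted set, can serve as
  representative.\<close>

lemma has_MAEHS_any_infinite_type:
  fixes \<theta> :: "('p, 'a::finite) fm"
  assumes "has_MAEHS TYPE('s) \<theta>" and "infinite (UNIV :: 't set)"
  shows "has_MAEHS TYPE('t) \<theta>"
proof -
  obtain N :: "('p, 'a, 's) hintikka_structure" and s0
    where N: "MAEHS N" and s0: "s0 \<in> states N" "\<theta> \<in> hint N s0"
    using assms(1) unfolding has_MAEHS_def MAEHS_for_def by blast
  obtain f :: "nat \<Rightarrow> 't" where "inj f"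
    using assms(2) infinite_countable_subset by blast
  \<comment> \<open>States of the quotient are codes of subsets of \<open>closure \<theta>\<close>.
    There are finitely many of these, so a copy of the natural numbers inside \<open>'t\<close> has
    room for them; \<open>h\<close> below decodes.\<close>
  define e where "e = f \<circ> to_nat_on (Pow (closure \<theta>))"
  have "countable (Pow (closure \<theta>))"
    by (intro countable_finite) (simp add: closure_def finite_expansion)
  then have e: "inj_on e (Pow (closure \<theta>))"
    unfolding e_def using \<open>inj f\<close> by (intro comp_inj_on inj_on_to_nat_on) (auto intro: inj_on_subset)
  define g where "g s = e (hint N s \<inter> closure \<theta>)" for s
  define h where "h = inv_into (Pow (closure \<theta>)) e"
  have hg: "h (g s) = hint N s \<inter> closure \<theta>" for s
    unfolding h_def g_def by (rule inv_into_f_f[OF e]) auto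
  define N' :: "('p, 'a, 't) hintikka_structure" where
    "N' = \<lparr>states = g ` states N, rel = (\<lambda>a. map_prod g g ` rel N a), relD = map_prod g g ` relD N,
      relC = (map_prod g g ` relD N \<union> (\<Union>a. map_prod g g ` rel N a))\<^sup>+, hint = h\<rparr>"
  have S: "MAES N"
    using N by (rule MAEHS_D)
  have R: "rel N' a = map_prod g g ` rel N a" "relD N' = map_prod g g ` relD N"
    "states N' = g ` states N" "hint N' = h" for a
    by (auto simp: N'_def)
  \<comment> \<open>Chains map to chains. This is the inclusion that carries over the last clause of
    \<open>MAEHS\<close>, which asks for the existence of a reachable witness.\<close>
  have relC: "(g s, g t) \<in> relC N'" if "(s, t) \<in> relC N" for s t
  proof -
    have "(s, t) \<in> (relD N \<union> (\<Union>a. rel N a))\<^sup>+"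
      using that S unfolding MAES_def by simp
    then have "(g s, g t) \<in> (map_prod g g ` (relD N \<union> (\<Union>a. rel N a)))\<^sup>+"
      by (rule trancl_map_prod)
    then show ?thesis
      by (simp add: N'_def image_Un image_UN)
  qed
  have sub: "s \<in> states N" "t \<in> states N" if "(s, t) \<in> rel N a" for s t a
    using S that unfolding MAES_def by blast+
  have subD: "s \<in> states N" "t \<in> states N" if "(s, t) \<in> relD N" for s t
    using S that unfolding MAES_def by blast+
  have "MAEHS N'"
    unfolding MAEHS_def
  proof (intro conjI)
    show "MAES N'"
      using S unfolding MAES_def N'_def by (simp add: map_prod_subset)
    show "\<forall>s\<in>states N'. \<forall>\<phi>. Neg \<phi> \<in> hint N' s \<longrightarrow> \<phi> \<notin> hint N' s"
      using MAEHS_D(2)[OF N] unfolding R by (auto simp: hg)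
    show "\<forall>s\<in>states N'. fully_expanded (hint N' s)"
      using MAEHS_D(3)[OF N] unfolding R by (auto simp: hg fully_expanded_Int_closure)
    show "\<forall>s\<in>states N'. \<forall>t a \<phi>. K a \<phi> \<in> hint N' s \<and> (s, t) \<in> rel N' a \<longrightarrow> \<phi> \<in> hint N' t"
    proof (intro ballI allI impI)
      fix s t a \<phi> assume *: "K a \<phi> \<in> hint N' s \<and> (s, t) \<in> rel N' a"
      then obtain u v where uv: "s = g u" "t = g v" "(u, v) \<in> rel N a"
        unfolding R by auto
      then have "K a \<phi> \<in> hint N u" "K a \<phi> \<in> closure \<theta>"
        using * by (auto simp: R hg)
      then have "\<phi> \<in> hint N v" "\<phi> \<in> closure \<theta>"
        using MAEHS_D(4)[OF N sub(1)[OF uv(3)] _ uv(3)]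
        by (blast, auto simp: closure_iff dest: expansion_components intro: expansion_subset_closure)
      then show "\<phi> \<in> hint N' t"
        by (simp add: uv R hg)
    qed
    show "\<forall>s\<in>states N'. \<forall>t \<phi>. D \<phi> \<in> hint N' s \<and> (s, t) \<in> relD N' \<longrightarrow> \<phi> \<in> hint N' t"
    proof (intro ballI allI impI)
      fix s t \<phi> assume *: "D \<phi> \<in> hint N' s \<and> (s, t) \<in> relD N'"
      then obtain u v where uv: "s = g u" "t = g v" "(u, v) \<in> relD N"
        unfolding R by auto
      then have "D \<phi> \<in> hint N u" "D \<phi> \<in> closure \<theta>"
        using * by (auto simp: R hg)
      then have "\<phi> \<in> hint N v" "\<phi> \<in> closure \<theta>"
        using MAEHS_D(7)[OF N subD(1)[OF uv(3)] _ uv(3)]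
        by (blast, auto simp: closure_iff dest: expansion_components intro: expansion_subset_closure)
      then show "\<phi> \<in> hint N' t"
        by (simp add: uv R hg)
    qed
    show "\<forall>s\<in>states N'. \<forall>a \<phi>. Neg (K a \<phi>) \<in> hint N' s \<longrightarrow>
        (\<exists>t. (s, t) \<in> rel N' a \<and> Neg \<phi> \<in> hint N' t)"
    proof (intro ballI allI impI)
      fix s a \<phi> assume *: "s \<in> states N'" "Neg (K a \<phi>) \<in> hint N' s"
      then obtain u where u: "s = g u" "u \<in> states N" unfolding R by auto
      with * have "Neg (K a \<phi>) \<in> hint N u" and cl: "Neg (K a \<phi>) \<in> closure \<theta>"
        by (auto simp: R hg)
      then obtain v where v: "(u, v) \<in> rel N a" "Neg \<phi> \<in> hint N v"
        using MAEHS_D(5)[OF N u(2)] by blast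
      moreover have "Neg \<phi> \<in> closure \<theta>"
        using cl by (auto simp: closure_iff dest: expansion_components)
      ultimately have "(s, g v) \<in> rel N' a" "Neg \<phi> \<in> hint N' (g v)"
        by (auto simp: R hg u)
      then show "\<exists>t. (s, t) \<in> rel N' a \<and> Neg \<phi> \<in> hint N' t" by blast
    qed
    show "\<forall>s\<in>states N'. \<forall>\<phi>. Neg (D \<phi>) \<in> hint N' s \<longrightarrow>
        (\<exists>t. (s, t) \<in> relD N' \<and> Neg \<phi> \<in> hint N' t)"
    proof (intro ballI allI impI)
      fix s \<phi> assume *: "s \<in> states N'" "Neg (D \<phi>) \<in> hint N' s"
      then obtain u where u: "s = g u" "u \<in> states N" unfolding R by auto
      with * have "Neg (D \<phi>) \<in> hint N u" and cl: "Neg (D \<phi>) \<in> closure \<theta>"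
        by (auto simp: R hg)
      then obtain v where v: "(u, v) \<in> relD N" "Neg \<phi> \<in> hint N v"
        using MAEHS_D(8)[OF N u(2)] by blast
      moreover have "Neg \<phi> \<in> closure \<theta>"
        using cl by (auto simp: closure_iff dest: expansion_components)
      ultimately have "(s, g v) \<in> relD N'" "Neg \<phi> \<in> hint N' (g v)"
        by (auto simp: R hg u)
      then show "\<exists>t. (s, t) \<in> relD N' \<and> Neg \<phi> \<in> hint N' t" by blast
    qed
    show "\<forall>s\<in>states N'. \<forall>\<phi>. Neg (C \<phi>) \<in> hint N' s \<longrightarrow>
        (\<exists>t. (s, t) \<in> relC N' \<and> Neg \<phi> \<in> hint N' t)"
    proof (intro ballI allI impI)
      fix s \<phi> assume *: "s \<in> states N'" "Neg (C \<phi>) \<in> hint N' s"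
      then obtain u where u: "s = g u" "u \<in> states N" unfolding R by auto
      with * have "Neg (C \<phi>) \<in> hint N u" and cl: "Neg (C \<phi>) \<in> closure \<theta>"
        by (auto simp: R hg)
      then obtain v where v: "(u, v) \<in> relC N" "Neg \<phi> \<in> hint N v"
        using MAEHS_D(11)[OF N u(2)] by blast
      moreover have "Neg \<phi> \<in> closure \<theta>"
        using cl by (auto simp: closure_iff dest: expansion_components)
      ultimately have "(s, g v) \<in> relC N'" "Neg \<phi> \<in> hint N' (g v)"
        by (auto simp: R hg u relC)
      then show "\<exists>t. (s, t) \<in> relC N' \<and> Neg \<phi> \<in> hint N' t" by blast
    qed
    show "\<forall>s t a. (s, t) \<in> rel N' a \<longrightarrow> (\<forall>\<phi>. K a \<phi> \<in> hint N' s \<longleftrightarrow> K a \<phi> \<in> hint N' t)"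
      using MAEHS_D(6)[OF N] unfolding R by (auto simp: hg)
    show "\<forall>s t. (s, t) \<in> relD N' \<longrightarrow>
        (\<forall>\<phi>. D \<phi> \<in> hint N' s \<longleftrightarrow> D \<phi> \<in> hint N' t) \<and>
        (\<forall>a \<phi>. K a \<phi> \<in> hint N' s \<longleftrightarrow> K a \<phi> \<in> hint N' t)"
      using MAEHS_D(9,10)[OF N] unfolding R by (auto simp: hg)
  qed
  moreover have "\<theta> \<in> hint N' (g s0)" "g s0 \<in> states N'"
    using s0 by (auto simp: R hg self_in_expansion expansion_subset_closure)
  ultimately show ?thesis
    unfolding has_MAEHS_def MAEHS_for_def by blast
qed

section \<open>Unravelling a Hintikka structure\<close>

text \<open>
  A path is the list of its steps, the most recent first; a step along an edge of agent \<open>a\<close> is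
  tagged \<open>Some a\<close>, and one along a \<open>D\<close>-edge is tagged \<open>None\<close>. The starting state \<open>s\<^sub>0\<close> is not stored.
\<close>

fun endpoint :: "'s \<Rightarrow> ('a option \<times> 's) list \<Rightarrow> 's" where
  "endpoint s0 [] = s0"
| "endpoint s0 ((l, t) # p) = t"

fun edges :: "('a, 's, 'z) epistemic_structure_scheme \<Rightarrow> 'a option \<Rightarrow> ('s \<times> 's) set" where
  "edges N None = relD N"
| "edges N (Some a) = rel N a"

inductive_set paths :: "('a, 's, 'z) epistemic_structure_scheme \<Rightarrow> 's \<Rightarrow> ('a option \<times> 's) list set"
  for N s0 where
  Nil: "[] \<in> paths N s0"
| Cons: "p \<in> paths N s0 \<Longrightarrow> (endpoint s0 p, t) \<in> edges N l \<Longrightarrow> (l, t) # p \<in> paths N s0"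

text \<open>The latest step is the head of the list, so \<open>dropWhile\<close> goes back along the
  path until it meets a step with a tag outside \<open>L\<close>.\<close>

definition strip :: "'a option set \<Rightarrow> ('a option \<times> 's) list \<Rightarrow> ('a option \<times> 's) list" where
  "strip L = dropWhile (\<lambda>x. fst x \<in> L)"

lemma strip_Cons: "strip L ((l, t) # p) = (if l \<in> L then strip L p else (l, t) # p)"
  by (simp add: strip_def)

lemma strip_Nil: "strip L [] = []"
  by (simp add: strip_def)

lemma strip_strip_subset: "L \<subseteq> L' \<Longrightarrow> strip L' (strip L p) = strip L' p"
  by (induction p) (auto simp: strip_def)

lemma strip_decomp: "\<exists>u. p = u @ strip L p \<and> (\<forall>x\<in>set u. fst x \<in> L)"
  unfolding strip_def by (metis takeWhile_dropWhile_id set_takeWhileD)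

lemma strip_append: "\<forall>x\<in>set u. fst x \<in> L \<Longrightarrow> strip L (u @ p) = strip L p"
  by (simp add: strip_def dropWhile_append2)

text \<open>
  The two remainders are suffixes of the same path, so one is a suffix of the other; the parts of
  \<open>p\<close> and \<open>q\<close> above the longer one then carry tags from both sets.
\<close>

lemma strip_Int_eq_aux:
  assumes "strip L p = strip L q" "strip L' p = strip L' q"
    and "length (strip L p) \<le> length (strip L' p)"
  shows "strip (L \<inter> L') p = strip (L \<inter> L') q"
proof -
  \<comment> \<open>With the shorter remainder being \<open>strip L x\<close>, the part
    \<open>v\<close> above \<open>strip L' x\<close> is an initial piece of the part
    \<open>u\<close> above \<open>strip L x\<close>; its tags thus lie in \<open>L'\<close> and in
    \<open>L\<close>.\<close>
  have above: "\<exists>u. x = u @ strip L' x \<and> (\<forall>y\<in>set u. fst y \<in> L \<inter> L')"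
    if len: "length (strip L x) \<le> length (strip L' x)" for x :: "('a option \<times> 'b) list"
  proof -
    obtain u where u: "x = u @ strip L x" "\<forall>y\<in>set u. fst y \<in> L"
      using strip_decomp by blast
    obtain v where v: "x = v @ strip L' x" "\<forall>y\<in>set v. fst y \<in> L'"
      using strip_decomp by blast
    have "length v \<le> length u"
      using len arg_cong[OF u(1), of length] arg_cong[OF v(1), of length] by simp
    moreover have "take (length v) x = v" "take (length u) x = u"
      by (subst v(1), simp, subst u(1), simp)
    ultimately have "set v \<subseteq> set u"
      by (metis set_take_subset_set_take)
    with u v show ?thesis by blast
  qed
  obtain u where "p = u @ strip L' p" "\<forall>y\<in>set u. fst y \<in> L \<inter> L'"
    using above assms(3) by blast
  moreover obtain v where "q = v @ strip L' q" "\<forall>y\<in>set v. fst y \<in> L \<inter> L'"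
    using above[of q] assms by auto
  \<comment> \<open>Both paths sit on the common remainder \<open>strip L' p = strip L' q\<close>,
    and stripping by \<open>L \<inter> L'\<close> removes everything above it.\<close>
  ultimately show ?thesis
    using assms(2) strip_append by metis
qed

lemma strip_Int_eq:
  assumes "strip L p = strip L q" "strip L' p = strip L' q"
  shows "strip (L \<inter> L') p = strip (L \<inter> L') q"
  using strip_Int_eq_aux[OF assms] strip_Int_eq_aux[OF assms(2,1)]
  by (cases "length (strip L p) \<le> length (strip L' p)") (auto simp: Int_commute)

text \<open>On the tree of paths this is the equivalence generated by the edges with tags in
  \<open>L\<close>. Written as the kernel of \<open>strip L\<close>, it is visibly an equivalence,
  and two related paths come with a common ancestor.\<close>

definition same_strip :: "('a, 's, 'z) epistemic_structure_scheme \<Rightarrow> 's \<Rightarrow> 'a option set \<Rightarrow>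
    (('a option \<times> 's) list \<times> ('a option \<times> 's) list) set" where
  "same_strip N s0 L = {(p, q). p \<in> paths N s0 \<and> q \<in> paths N s0 \<and> strip L p = strip L q}"

text \<open>\<open>None\<close> is among the tags of every agent so that a \<open>D\<close>-step is
  a step for each of them.\<close>

definition unravelling :: "('p, 'a, 's) hintikka_structure \<Rightarrow> 's \<Rightarrow>
    ('p, 'a, ('a option \<times> 's) list) labelled_structure" where
  "unravelling N s0 =
     \<lparr>states = paths N s0,
      rel = (\<lambda>a. same_strip N s0 {None, Some a}),
      relD = same_strip N s0 {None},
      relC = (same_strip N s0 {None} \<union> (\<Union>a. same_strip N s0 {None, Some a}))\<^sup>+,
      label = (\<lambda>p. {x. Atom x \<in> hint N (endpoint s0 p)})\<rparr>"

lemma unravelling_simps: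
  "states (unravelling N s0) = paths N s0"
  "rel (unravelling N s0) a = same_strip N s0 {None, Some a}"
  "relD (unravelling N s0) = same_strip N s0 {None}"
  "relC (unravelling N s0) =
     (same_strip N s0 {None} \<union> (\<Union>a. same_strip N s0 {None, Some a}))\<^sup>+"
  "label (unravelling N s0) p = {x. Atom x \<in> hint N (endpoint s0 p)}"
  by (simp_all add: unravelling_def)

lemma equiv_same_strip: "equiv (paths N s0) (same_strip N s0 L)"
  by (auto simp: equiv_def refl_on_def sym_def trans_def same_strip_def)

lemma same_strip_mono: "L \<subseteq> L' \<Longrightarrow> same_strip N s0 L \<subseteq> same_strip N s0 L'"
  unfolding same_strip_def by clarify (metis strip_strip_subset)

lemma same_strip_Cons:
  assumes "p \<in> paths N s0" "(endpoint s0 p, t) \<in> edges N l" "l \<in> L"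
  shows "(p, (l, t) # p) \<in> same_strip N s0 L"
  using assms by (auto simp: same_strip_def strip_Cons intro: paths.Cons)

text \<open>The tag sets of two distinct agents meet exactly in \<open>{None}\<close>, so already
  these two relations intersect in the one for \<open>D\<close>, by
  \<open>strip_Int_eq\<close>.\<close>

lemma INT_same_strip:
  fixes N :: "('a, 's, 'z) epistemic_structure_scheme" and a b :: 'a
  assumes "a \<noteq> b"
  shows "(\<Inter>c. same_strip N s0 {None, Some c}) = same_strip N s0 {None}"
proof
  have "same_strip N s0 {None, Some a} \<inter> same_strip N s0 {None, Some b} \<subseteq> same_strip N s0 {None}"
    using assms strip_Int_eq[of "{None, Some a}" _ _ "{None, Some b}"]
    by (auto simp: same_strip_def)
  then show "(\<Inter>c. same_strip N s0 {None, Some c}) \<subseteq> same_strip N s0 {None}"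
    by blast
  show "same_strip N s0 {None} \<subseteq> (\<Inter>c. same_strip N s0 {None, Some c})"
    by (intro INT_greatest same_strip_mono) simp
qed

lemma MAEM_unravelling:
  fixes N :: "('p, 'a, 's) hintikka_structure" and a b :: 'a
  assumes "a \<noteq> b"
  shows "MAEM (unravelling N s0)"
proof -
  have "paths N s0 \<noteq> {}"
    using paths.Nil[of N s0] by auto
  moreover have "same_strip N s0 L \<subseteq> paths N s0 \<times> paths N s0" for L
    by (auto simp: same_strip_def)
  ultimately show ?thesis
    unfolding MAEM_def MAES_def unravelling_simps
    using equiv_same_strip INT_same_strip[OF assms] by metis
qed

section \<open>The truth lemma for the unravelling\<close>

lemma endpoint_in_states:
  assumes "MAES N" "s0 \<in> states N" "p \<in> paths N s0"
  shows "endpoint s0 p \<in> states N"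
  using assms(3)
proof cases
  case (Cons q t l)
  then show ?thesis
    using assms(1) unfolding MAES_def by (cases l) auto
qed (simp add: assms)

text \<open>\<open>K a\<close>-formulas are invariant in both directions along the edges of
  \<open>a\<close> and of \<open>D\<close>, exactly those that are stripped. The equivalence allows
  passing from one path down to the common remainder and up again to another path.\<close>

lemma hint_K_strip:
  assumes "MAEHS N" "p \<in> paths N s0"
  shows "K a \<phi> \<in> hint N (endpoint s0 (strip {None, Some a} p)) \<longleftrightarrow> K a \<phi> \<in> hint N (endpoint s0 p)"
  using assms(2)
proof induction
  case (Cons p t l)
  have "K a \<phi> \<in> hint N (endpoint s0 p) \<longleftrightarrow> K a \<phi> \<in> hint N t" if "l \<in> {None, Some a}"
    using that Cons.hyps MAEHS_D(6,10)[OF assms(1)] by auto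
  with Cons.IH show ?case by (auto simp: strip_Cons)
qed (simp add: strip_Nil)

lemma hint_D_strip:
  assumes "MAEHS N" "p \<in> paths N s0"
  shows "D \<phi> \<in> hint N (endpoint s0 (strip {None} p)) \<longleftrightarrow> D \<phi> \<in> hint N (endpoint s0 p)"
  using assms(2)
proof induction
  case (Cons p t l)
  have "D \<phi> \<in> hint N (endpoint s0 p) \<longleftrightarrow> D \<phi> \<in> hint N t" if "l = None"
    using that Cons.hyps MAEHS_D(9)[OF assms(1)] by auto
  with Cons.IH show ?case by (auto simp: strip_Cons)
qed (simp add: strip_Nil)

text \<open>A chain of edges in \<open>N\<close> is retraced by extending \<open>p\<close> one step
  at a time; each extension is related to its predecessor by \<open>same_strip_Cons\<close>.\<close>

lemma relC_path_lift:
  assumes "MAES N" "p \<in> paths N s0" "(endpoint s0 p, t) \<in> relC N"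
  shows "\<exists>q. (p, q) \<in> relC (unravelling N s0) \<and> q \<in> paths N s0 \<and> endpoint s0 q = t"
proof -
  let ?r = "same_strip N s0 {None} \<union> (\<Union>a. same_strip N s0 {None, Some a})"
  have ext: "\<exists>q'. (q, q') \<in> ?r \<and> q' \<in> paths N s0 \<and> endpoint s0 q' = u"
    if q: "q \<in> paths N s0" and u: "(endpoint s0 q, u) \<in> relD N \<union> (\<Union>a. rel N a)" for q u
  proof -
    obtain l where l: "(endpoint s0 q, u) \<in> edges N l"
      using u edges.simps by (metis UN_E Un_iff)
    then have "(q, (l, u) # q) \<in> ?r"
      using same_strip_Cons[OF q l] by (cases l) auto
    moreover have "(l, u) # q \<in> paths N s0"
      using q l by (rule paths.Cons)
    ultimately show ?thesis
      by (metis endpoint.simps(2))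
  qed
  have "(endpoint s0 p, t) \<in> (relD N \<union> (\<Union>a. rel N a))\<^sup>+"
    using assms(1,3) unfolding MAES_def by simp
  then have "\<exists>q. (p, q) \<in> ?r\<^sup>+ \<and> q \<in> paths N s0 \<and> endpoint s0 q = t"
  proof induction
    case (base u)
    then show ?case
      using ext[OF assms(2)] by blast
  next
    case (step t u)
    then obtain q where q: "(p, q) \<in> ?r\<^sup>+" "q \<in> paths N s0" "endpoint s0 q = t"
      by blast
    then show ?case
      using ext[of q u] step.hyps by (meson trancl_into_trancl)
  qed
  then show ?thesis
    by (simp add: unravelling_simps)
qed

text \<open>A Hintikka set need not decide every formula, so membership only implies truth. The
  negative half is carried along in the induction because the positive half for
  \<open>Neg \<phi>\<close> is the negative half for \<open>\<phi>\<close>.\<close>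

lemma unravelling_truth:
  fixes N :: "('p, 'a, 's) hintikka_structure"
  assumes N: "MAEHS N" and s0: "s0 \<in> states N" and "p \<in> paths N s0"
  shows "(\<phi> \<in> hint N (endpoint s0 p) \<longrightarrow> sat (unravelling N s0) p \<phi>) \<and>
    (Neg \<phi> \<in> hint N (endpoint s0 p) \<longrightarrow> \<not> sat (unravelling N s0) p \<phi>)"
proof -
  let ?M = "unravelling N s0" and ?H = "\<lambda>p. hint N (endpoint s0 p)"
  have S: "MAES N"
    using N by (rule MAEHS_D)
  have st: "endpoint s0 p \<in> states N" if "p \<in> paths N s0" for p
    using endpoint_in_states[OF S s0 that] .
  have exp: "fully_expanded (?H p)" if "p \<in> paths N s0" for p
    using MAEHS_D(3)[OF N st[OF that]] .
  \<comment> \<open>\<open>K a \<psi>\<close> travels through the common remainder to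
    \<open>q\<close>; full expansion at \<open>q\<close> then gives \<open>D \<psi>\<close> and from
    it \<open>\<psi>\<close>.\<close>
  have K_step: "\<psi> \<in> ?H q" if "K a \<psi> \<in> ?H p" "(p, q) \<in> rel ?M a" for p q a \<psi>
  proof -
    have "p \<in> paths N s0" "q \<in> paths N s0" "strip {None, Some a} p = strip {None, Some a} q"
      using that by (auto simp: unravelling_simps same_strip_def)
    then have "K a \<psi> \<in> ?H q"
      using that(1) hint_K_strip[OF N] by metis
    then show ?thesis
      using fully_expanded_D(4,5)[OF exp[OF \<open>q \<in> paths N s0\<close>]] by blast
  qed
  have D_step: "\<psi> \<in> ?H q" if "D \<psi> \<in> ?H p" "(p, q) \<in> relD ?M" for p q \<psi>
  proof -
    have "p \<in> paths N s0" "q \<in> paths N s0" "strip {None} p = strip {None} q"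
      using that by (auto simp: unravelling_simps same_strip_def)
    then have "D \<psi> \<in> ?H q"
      using that(1) hint_D_strip[OF N] by metis
    then show ?thesis
      using fully_expanded_D(4,5)[OF exp[OF \<open>q \<in> paths N s0\<close>]] by blast
  qed
  \<comment> \<open>A \<open>D\<close>-step counts as a step of an arbitrary agent. The unfolding of
    \<open>C \<psi>\<close> then delivers \<open>\<psi>\<close> and also \<open>C \<psi>\<close>
    itself, which keeps the induction along chains going.\<close>
  have C_step: "\<psi> \<in> ?H q \<and> C \<psi> \<in> ?H q"
    if C: "C \<psi> \<in> ?H p" and pq: "(p, q) \<in> relD ?M \<union> (\<Union>a. rel ?M a)" for p q \<psi>
  proof -
    obtain a where a: "(p, q) \<in> rel ?M a"
      using pq same_strip_mono[of "{None}" "{None, Some _}" N s0] by (auto simp: unravelling_simps)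
    then have p: "p \<in> paths N s0" and q: "q \<in> paths N s0"
      by (auto simp: unravelling_simps same_strip_def)
    have "K a (Conj \<psi> (C \<psi>)) \<in> ?H p"
      using fully_expanded_D(6)[OF exp[OF p] C] .
    then have "Conj \<psi> (C \<psi>) \<in> ?H q"
      using a K_step by blast
    then show ?thesis
      using fully_expanded_D(2)[OF exp[OF q]] by blast
  qed
  have C_trancl: "\<psi> \<in> ?H q \<and> C \<psi> \<in> ?H q" if C: "C \<psi> \<in> ?H p" and "(p, q) \<in> relC ?M" for p q \<psi>
  proof -
    have "(p, q) \<in> (relD ?M \<union> (\<Union>a. rel ?M a))\<^sup>+"
      using that by (simp add: unravelling_simps)
    then show ?thesis
      by induction (use C_step C in blast)+
  qed
  have relC_paths: "q \<in> paths N s0" if "(p, q) \<in> relC ?M" for p q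
    using that by (auto simp: unravelling_simps same_strip_def elim: tranclE)
  show ?thesis
    using assms(3)
  proof (induction \<phi> arbitrary: p)
    case (Atom x)
    then show ?case
      using MAEHS_D(2)[OF N st[OF Atom]] by (auto simp: unravelling_simps)
  next
    case (Neg \<phi>)
    then show ?case
      using fully_expanded_D(1)[OF exp[OF Neg.prems]] by auto
  next
    case (Conj \<phi> \<psi>)
    then show ?case
      using fully_expanded_D(2,3)[OF exp[OF Conj.prems]] by (meson sat.simps(3))
  next
    case (K a \<phi>)
    have "sat ?M p (K a \<phi>)" if "K a \<phi> \<in> ?H p"
      using that K_step K.IH by (auto simp: unravelling_simps same_strip_def)
    moreover have "\<not> sat ?M p (K a \<phi>)" if neg: "Neg (K a \<phi>) \<in> ?H p"
    proof -
      \<comment> \<open>The witness in \<open>N\<close> becomes a new child of \<open>p\<close>,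
        tagged with \<open>a\<close>.\<close>
      obtain t where t: "(endpoint s0 p, t) \<in> edges N (Some a)" "Neg \<phi> \<in> hint N t"
        using MAEHS_D(5)[OF N st[OF K.prems] neg] by auto
      have "(p, (Some a, t) # p) \<in> rel ?M a"
        using same_strip_Cons[OF K.prems t(1)] by (simp add: unravelling_simps)
      moreover have "\<not> sat ?M ((Some a, t) # p) \<phi>"
        using K.IH[OF paths.Cons[OF K.prems t(1)]] t(2) by simp
      ultimately show ?thesis by auto
    qed
    ultimately show ?case by blast
  next
    case (D \<phi>)
    have "sat ?M p (D \<phi>)" if "D \<phi> \<in> ?H p"
      using that D_step D.IH by (auto simp: unravelling_simps same_strip_def)
    moreover have "\<not> sat ?M p (D \<phi>)" if neg: "Neg (D \<phi>) \<in> ?H p"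
    proof -
      obtain t where t: "(endpoint s0 p, t) \<in> edges N None" "Neg \<phi> \<in> hint N t"
        using MAEHS_D(8)[OF N st[OF D.prems] neg] by auto
      have "(p, (None, t) # p) \<in> relD ?M"
        using same_strip_Cons[OF D.prems t(1)] by (simp add: unravelling_simps)
      moreover have "\<not> sat ?M ((None, t) # p) \<phi>"
        using D.IH[OF paths.Cons[OF D.prems t(1)]] t(2) by simp
      ultimately show ?thesis by auto
    qed
    ultimately show ?case by blast
  next
    case (C \<phi>)
    have "sat ?M p (C \<phi>)" if "C \<phi> \<in> ?H p"
      unfolding sat.simps using C_trancl[OF that] C.IH relC_paths by blast
    moreover have "\<not> sat ?M p (C \<phi>)" if neg: "Neg (C \<phi>) \<in> ?H p"
    proof -
      obtain t where t: "(endpoint s0 p, t) \<in> relC N" "Neg \<phi> \<in> hint N t"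
        using MAEHS_D(11)[OF N st[OF C.prems] neg] by blast
      then obtain q where "(p, q) \<in> relC ?M" "q \<in> paths N s0" "Neg \<phi> \<in> ?H q"
        using relC_path_lift[OF S C.prems] by blast
      then show ?thesis
        using C.IH by auto
    qed
    ultimately show ?case by blast
  qed
qed

section \<open>Transfer of models along injections\<close>

text \<open>Consecutive image edges meet in a point with a unique preimage, so a chain starting at
  \<open>f s\<close> lifts to a chain starting at \<open>s\<close>.\<close>

lemma trancl_map_prod_inj:
  assumes "inj f" "(f s, y) \<in> (map_prod f f ` r)\<^sup>+"
  shows "\<exists>t. y = f t \<and> (s, t) \<in> r\<^sup>+"
  using assms(2)
proof induction
  case (base y)
  then show ?case
    using assms(1) by (auto dest: injD)
next
  case (step y z)
  then obtain t where t: "y = f t" "(s, t) \<in> r\<^sup>+"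
    by blast
  then obtain u where "z = f u" "(t, u) \<in> r"
    using step.hyps assms(1) by (auto dest: injD)
  with t show ?case
    by (blast intro: trancl_into_trancl)
qed

lemma equiv_map_prod:
  assumes "inj f" "equiv A r"
  shows "equiv (f ` A) (map_prod f f ` r)"
proof -
  have "trans (map_prod f f ` r)"
  proof (rule transI)
    fix x y z assume "(x, y) \<in> map_prod f f ` r" "(y, z) \<in> map_prod f f ` r"
    then obtain s t t' u where "x = f s" "y = f t" "(s, t) \<in> r" "y = f t'" "z = f u" "(t', u) \<in> r"
      by (elim prod_fun_imageE) blast
    moreover from this have "t = t'"
      using assms(1) by (auto dest: injD)
    ultimately show "(x, z) \<in> map_prod f f ` r"
      using assms(2) by (metis equivE transD map_prod_imageI)
  qed
  moreover have "sym (map_prod f f ` r)"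
    using assms(2) unfolding equiv_def sym_def by auto
  moreover have "refl_on (f ` A) (map_prod f f ` r)"
    using assms(2) unfolding equiv_def refl_on_def by auto
  moreover have "map_prod f f ` r \<subseteq> f ` A \<times> f ` A"
    using equiv_type[OF assms(2)] by auto
  ultimately show ?thesis
    by (simp add: equiv_def)
qed

lemma satisfiable_inj:
  fixes \<theta> :: "('p, 'a) fm" and f :: "'s \<Rightarrow> 't"
  assumes "satisfiable TYPE('s) \<theta>" "inj f"
  shows "satisfiable TYPE('t) \<theta>"
proof -
  obtain M :: "('p, 'a, 's) labelled_structure" and s where M: "MAEM M" "s \<in> states M" "sat M s \<theta>"
    using assms(1) unfolding satisfiable_def by blast
  let ?f = "map_prod f f"
  \<comment> \<open>\<open>inv f\<close> recovers the preimage of a state; outside the range of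
    \<open>f\<close>, where labels are arbitrary, there are no states.\<close>
  define M' :: "('p, 'a, 't) labelled_structure" where
    "M' = \<lparr>states = f ` states M, rel = (\<lambda>a. ?f ` rel M a), relD = ?f ` relD M,
       relC = (?f ` relD M \<union> (\<Union>a. ?f ` rel M a))\<^sup>+, label = (\<lambda>x. label M (inv f x))\<rparr>"
  have R: "states M' = f ` states M" "rel M' a = ?f ` rel M a" "relD M' = ?f ` relD M"
    "label M' (f s) = label M s" for a s
    using assms(2) by (auto simp: M'_def)
  \<comment> \<open>By injectivity the successors of \<open>f s\<close> are exactly the images of
    those of \<open>s\<close>, so the modal clauses agree on both sides.\<close>
  have mem: "(f s, y) \<in> ?f ` r \<longleftrightarrow> (\<exists>t. y = f t \<and> (s, t) \<in> r)" for s y r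
    using assms(2) by (auto dest: injD)
  have "relC M' = (?f ` (relD M \<union> (\<Union>a. rel M a)))\<^sup>+"
    by (simp add: M'_def image_Un image_UN)
  moreover have "relC M = (relD M \<union> (\<Union>a. rel M a))\<^sup>+"
    using M(1) unfolding MAEM_def MAES_def by blast
  ultimately have memC: "(f s, y) \<in> relC M' \<longleftrightarrow> (\<exists>t. y = f t \<and> (s, t) \<in> relC M)" for s y
    using trancl_map_prod_inj[OF assms(2)] trancl_map_prod[of _ _ _ f] by metis
  have "sat M' (f s) \<phi> \<longleftrightarrow> sat M s \<phi>" for s \<phi>
    by (induction \<phi> arbitrary: s) (auto simp: R(2,3,4) mem memC simp del: map_prod_imageI)
  moreover have "MAEM M'"
  proof -
    \<comment> \<open>Injectivity is essential here: in general the image of an intersection is only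
      contained in the intersection of the images.\<close>
    have "?f ` (\<Inter>a. rel M a) = (\<Inter>a. ?f ` rel M a)"
      by (rule image_INT[of _ UNIV]) (use assms(2) in \<open>auto intro: prod.inj_map\<close>)
    moreover have "MAES M'"
      using conjunct1[OF M(1)[unfolded MAEM_def]] unfolding MAES_def M'_def
      by (simp add: map_prod_subset)
    ultimately show ?thesis
      using M(1) equiv_map_prod[OF assms(2)] unfolding MAEM_def R by metis
  qed
  ultimately show ?thesis
    using M unfolding satisfiable_def by (metis R(1) imageI)
qed

section \<open>The two directions of the equivalence\<close>

lemma satisfiable_if_has_MAEHS:
  fixes \<theta> :: "('p, 'a::finite) fm"
  assumes "CARD('a) \<ge> 2" "infinite (UNIV :: 's set)" "has_MAEHS TYPE('t) \<theta>"
  shows "satisfiable TYPE('s) \<theta>"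
proof -
  \<comment> \<open>Paths over \<open>nat\<close> with finitely many agents form a countable type,
    so the unravelled model can be embedded into any infinite type \<open>'s\<close>.\<close>
  have "has_MAEHS TYPE(nat) \<theta>"
    using assms(3) infinite_UNIV_nat by (rule has_MAEHS_any_infinite_type)
  then obtain N :: "('p, 'a, nat) hintikka_structure" and s0
    where N: "MAEHS N" and s0: "s0 \<in> states N" "\<theta> \<in> hint N s0"
    unfolding has_MAEHS_def MAEHS_for_def by blast
  obtain a b :: 'a where "a \<noteq> b"
    using assms(1) by (metis UNIV_I card_le_Suc0_iff_eq finite_class.finite_UNIV not_less_eq_eq numeral_2_eq_2)
  then have "MAEM (unravelling N s0)"
    by (rule MAEM_unravelling)
  moreover have "sat (unravelling N s0) [] \<theta>"
    using unravelling_truth[OF N s0(1) paths.Nil] s0(2) by simp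
  ultimately have "satisfiable TYPE(('a option \<times> nat) list) \<theta>"
    unfolding satisfiable_def using paths.Nil by (metis unravelling_simps(1))
  moreover obtain f :: "nat \<Rightarrow> 's" where "inj f"
    using assms(2) infinite_countable_subset by blast
  then have "inj (f \<circ> (to_nat :: ('a option \<times> nat) list \<Rightarrow> nat))"
    by (intro inj_compose) simp_all
  ultimately show ?thesis
    by (rule satisfiable_inj)
qed

lemma has_MAEHS_if_satisfiable:
  fixes \<theta> :: "('p, 'a) fm"
  assumes "satisfiable TYPE('s) \<theta>"
  shows "has_MAEHS TYPE('s) \<theta>"
proof -
  obtain M :: "('p, 'a, 's) labelled_structure" and s where M: "MAEM M" "s \<in> states M" "sat M s \<theta>"
    using assms unfolding satisfiable_def by blast
  with MAEHS_truth_sets[OF M(1)] show ?thesis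
    unfolding has_MAEHS_def MAEHS_for_def by force
qed

theorem theorem1:
  fixes \<theta> :: "('p, 'a::finite) fm"
  assumes "CARD('a) \<ge> 2"
    and "infinite (UNIV :: 's set)"
    and "infinite (UNIV :: 't set)"
  shows "satisfiable TYPE('s) \<theta> \<longleftrightarrow> has_MAEHS TYPE('t) \<theta>"
proof
  assume "satisfiable TYPE('s) \<theta>"
  then have "has_MAEHS TYPE('s) \<theta>"
    by (rule has_MAEHS_if_satisfiable)
  then show "has_MAEHS TYPE('t) \<theta>"
    using assms(3) by (rule has_MAEHS_any_infinite_type)
next
  assume "has_MAEHS TYPE('t) \<theta>"
  with assms(1,2) show "satisfiable TYPE('s) \<theta>"
    by (rule satisfiable_if_has_MAEHS)
qed

end
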